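(* Let $\psi:\mathfrak{g}^J\to C^\infty(\mathbb{S}^J)$ be the linear map defined on the basis $\{F,G,H,P,Q,R\}$ of the Lie algebra $\mathfrak{g}^J$ of the Jacobi group $G^J(\mathbb{R})$ by $$F\mapsto-\eta_2,\quad G\mapsto\tfrac14\dot\theta_1^2+\eta_2\dot\theta_2^2+\eta_1\dot\theta_1\dot\theta_2-\tfrac{1}{4(\eta_1^2-\eta_2)},\quad H\mapsto-\eta_1\dot\theta_1-2\eta_2\dot\theta_2,$$ $$P\mapsto\tfrac12\dot\theta_1+\eta_1\dot\theta_2,\quad Q\mapsto\eta_1,\quad R\mapsto-\tfrac14.$$ Then for every $L\in\mathfrak{g}^J$, the Hamiltonian vector field of $\psi(L)$ with respect to $\omega_{KB}$ coincides with the fundamental vector field generated by $L$, that is, $X_{\psi(L)}=L_{\mathbb{S}^J}$. Therefore, the map $\mathbf{J}:\mathbb{S}^J\to(\mathfrak{g}^J)^*$ defined by $\mathbf{J}(p)(L):=\psi(L)(p)$ ($p\in\mathbb{S}^J$, $L\in\mathfrak{g}^J$) is a momentum map for the action of $G^J(\mathbb{R})$ on $(\mathbb{S}^J,\omega_{KB})$.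
   Context: The Siegel-Jacobi space $\mathbb{S}^J$ is the complex manifold $\mathbb{H}\times\mathbb{C}$ ($\mathbb{H}$ the upper half-plane) with the Kähler metric $g_{KB}$ whose matrix in the coordinates $(u,v,x,y)$ ($\tau=u+iv\in\mathbb{H}$, $z=x+iy\in\mathbb{C}$) is $$\frac12\begin{bmatrix}\frac{v+y^2}{v^3}&0&-\frac{y}{v^2}&0\\0&\frac{v+y^2}{v^3}&0&-\frac{y}{v^2}\\-\frac{y}{v^2}&0&\frac1v&0\\0&-\frac{y}{v^2}&0&\frac1v\end{bmatrix},$$ and symplectic form $\omega_{KB}=g_{KB}(J\cdot,\cdot)$, $J$ being the complex structure. Coordinates $(\theta_1,\theta_2,\dot\theta_1,\dot\theta_2)$ on $\mathbb{S}^J$ ($\theta_2<0$) are defined by $\tau=\dot\theta_2-i\theta_2$, $z=-\dot\theta_1+i\theta_1$, and $\eta_1=-\frac{\theta_1}{2\theta_2}$, $\eta_2=\frac{\theta_1^2-2\theta_2}{4\theta_2^2}$. The Jacobi group $G^J(\mathbb{R})$ is $\mathrm{SL}(2,\mathbb{R})\times\mathbb{R}^2\times\mathbb{R}$ with multiplication $(M_1,X_1,\kappa_1)\cdot(M_2,X_2,\kappa_2)=(M_1M_2,X_1M_2+X_2,\kappa_1+\kappa_2+\Omega(X_1M_2,X_2))$ (row vectors $X_i$; $\Omega(\xi,\eta)=\xi_1\eta_2-\xi_2\eta_1$), acting on $\mathbb{H}\times\mathbb{C}$ by $\big(\big[\begin{smallmatrix}a&b\\c&d\end{smallmatrix}\big],(\lambda,\mu,\kappa)\big)\cdot(\tau,z)=\big(\frac{a\tau+b}{c\tau+d},\frac{z+\lambda\tau+\mu}{c\tau+d}\big)$.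 Its Lie algebra is $\mathfrak{g}^J=\mathfrak{sl}(2,\mathbb{R})\times\mathbb{R}^2\times\mathbb{R}$ with bracket $[(A,\xi,r),(B,\eta,s)]=([A,B],\xi B-\eta A,2\Omega(\xi,\eta))$. Basis: $F=\big[\begin{smallmatrix}0&1\\0&0\end{smallmatrix}\big]$, $G=\big[\begin{smallmatrix}0&0\\1&0\end{smallmatrix}\big]$, $H=\big[\begin{smallmatrix}1&0\\0&-1\end{smallmatrix}\big]$ in $\mathfrak{sl}(2,\mathbb{R})$, and $P=(1,0,0)$, $Q=(0,1,0)$, $R=(0,0,1)$ in $\mathbb{R}^2\times\mathbb{R}$. Conventions: the Hamiltonian vector field $X_f$ satisfies $\omega(X_f,\cdot)=df$; the fundamental vector field of $L$ is $(L_M)_p=\frac{d}{dt}\big|_0\exp(tL)\cdot p$; a momentum map for an action of a Lie group with Lie algebra $\mathfrak{g}$ on $(M,\omega)$ is a smooth map $\mathbf{J}:M\to\mathfrak{g}^*$ such that $L_M=X_{\mathbf{J}^L}$ for all $L\in\mathfrak{g}$, where $\mathbf{J}^L(p)=\mathbf{J}(p)(L)$. *)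

theory Defs
  imports "HOL-Analysis.Analysis" "HOL-Algebra.Group"
begin

section \<open>Smooth maps, Hamiltonian vector fields, momentum maps\<close>

text \<open>The manifold is an open subset \<open>M\<close> of a real normed vector space, so that every tangent space
  is identified with the ambient space. For a finite-dimensional domain, \<open>diff_times_on n\<close> on an open
  set is the class of n times differentiable maps with continuous n-th derivatives.\<close>

fun diff_times_on :: "nat \<Rightarrow> 'a::real_normed_vector set \<Rightarrow> ('a \<Rightarrow> 'b::real_normed_vector) \<Rightarrow> bool"
  where
    "diff_times_on 0 S f \<longleftrightarrow> continuous_on S f"
  | "diff_times_on (Suc n) S f \<longleftrightarrow>
       (\<forall>x\<in>S. f differentiable (at x)) \<and>
       (\<forall>v. diff_times_on n S (\<lambda>x. frechet_derivative f (at x) v))"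

definition smooth_on :: "'a::real_normed_vector set \<Rightarrow> ('a \<Rightarrow> 'b::real_normed_vector) \<Rightarrow> bool"
  where "smooth_on S f \<longleftrightarrow> open S \<and> (\<forall>n. diff_times_on n S f)"

text \<open>A two-form is given as \<open>\<omega> p X Y\<close> with base point \<open>p\<close>. The description below is proper as soon as
  \<open>\<omega> p\<close> is nondegenerate and \<open>f\<close> is differentiable at \<open>p\<close>; see
  \<open>hamiltonian_vector_field_siegel_jacobi\<close> below.\<close>

definition hamiltonian_vector_field ::
    "('a::real_normed_vector \<Rightarrow> 'a \<Rightarrow> 'a \<Rightarrow> real) \<Rightarrow> ('a \<Rightarrow> real) \<Rightarrow> 'a \<Rightarrow> 'a"
  where "hamiltonian_vector_field \<omega> f p = (THE X. (f has_derivative \<omega> p X) (at p))"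

text \<open>A Lie group \<open>G\<close> is given as a group whose carrier is a submanifold of a normed vector space;
  its Lie algebra is a type \<open>'l\<close> together with the linear map \<open>\<iota>\<close> identifying it with the tangent
  space at the identity. The description in \<open>lie_exp\<close> is proper since every element of the Lie
  algebra generates exactly one one-parameter subgroup.\<close>

definition one_parameter_subgroup ::
    "('g::real_normed_vector, 'm) monoid_scheme \<Rightarrow> ('l \<Rightarrow> 'g) \<Rightarrow> 'l \<Rightarrow> (real \<Rightarrow> 'g) \<Rightarrow> bool"
  where "one_parameter_subgroup G \<iota> L \<gamma> \<longleftrightarrow>
    smooth_on UNIV \<gamma> \<and> range \<gamma> \<subseteq> carrier G \<and>
    (\<forall>s t. \<gamma> (s + t) = \<gamma> s \<otimes>\<^bsub>G\<^esub> \<gamma> t) \<and> (\<gamma> has_vector_derivative \<iota> L) (at 0)"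

definition lie_exp ::
    "('g::real_normed_vector, 'm) monoid_scheme \<Rightarrow> ('l \<Rightarrow> 'g) \<Rightarrow> 'l \<Rightarrow> 'g"
  where "lie_exp G \<iota> L = (THE \<gamma>. one_parameter_subgroup G \<iota> L \<gamma>) 1"

definition fundamental_vector_field ::
    "('g::real_normed_vector, 'm) monoid_scheme \<Rightarrow> ('l::real_vector \<Rightarrow> 'g) \<Rightarrow>
     ('g \<Rightarrow> 'a \<Rightarrow> 'a::real_normed_vector) \<Rightarrow> 'l \<Rightarrow> 'a \<Rightarrow> 'a"
  where "fundamental_vector_field G \<iota> act L p =
    vector_derivative (\<lambda>t. act (lie_exp G \<iota> (t *\<^sub>R L)) p) (at 0)"

text \<open>The dual of the Lie algebra is the space of bounded linear functionals; for a
  finite-dimensional \<open>'l\<close> this is the full algebraic dual, and smoothness of \<open>J\<close> refers to its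
  operator norm.\<close>

definition is_momentum_map ::
    "'a::real_normed_vector set \<Rightarrow> ('a \<Rightarrow> 'a \<Rightarrow> 'a \<Rightarrow> real) \<Rightarrow>
     ('g::real_normed_vector, 'm) monoid_scheme \<Rightarrow> ('l::real_normed_vector \<Rightarrow> 'g) \<Rightarrow>
     ('g \<Rightarrow> 'a \<Rightarrow> 'a) \<Rightarrow> ('a \<Rightarrow> 'l \<Rightarrow>\<^sub>L real) \<Rightarrow> bool"
  where "is_momentum_map M \<omega> G \<iota> act J \<longleftrightarrow>
    smooth_on M J \<and>
    (\<forall>L. \<forall>p\<in>M. fundamental_vector_field G \<iota> act L p =
                hamiltonian_vector_field \<omega> (\<lambda>q. blinfun_apply (J q) L) p)"


section \<open>The Siegel-Jacobi space\<close>

text \<open>A point is \<open>(\<tau>, z)\<close>; a tangent vector is written in the same way.\<close>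

definition siegel_jacobi :: "(complex \<times> complex) set"
  where "siegel_jacobi = {(\<tau>, z). Im \<tau> > 0}"

definition real_coords :: "complex \<times> complex \<Rightarrow> real^4"
  where "real_coords X = vector [Re (fst X), Im (fst X), Re (snd X), Im (snd X)]"

definition KB_matrix :: "complex \<times> complex \<Rightarrow> real^4^4"
  where "KB_matrix p = (let v = Im (fst p); y = Im (snd p) in
    (1/2) *\<^sub>R vector
      [vector [(v + y\<^sup>2) / v^3, 0, - y / v\<^sup>2, 0],
       vector [0, (v + y\<^sup>2) / v^3, 0, - y / v\<^sup>2],
       vector [- y / v\<^sup>2, 0, 1 / v, 0],
       vector [0, - y / v\<^sup>2, 0, 1 / v]])"

definition g_KB :: "complex \<times> complex \<Rightarrow> complex \<times> complex \<Rightarrow> complex \<times> complex \<Rightarrow> real"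
  where "g_KB p X Y = real_coords X \<bullet> (KB_matrix p *v real_coords Y)"

definition complex_structure :: "complex \<times> complex \<Rightarrow> complex \<times> complex"
  where "complex_structure X = (\<i> * fst X, \<i> * snd X)"

definition \<omega>_KB :: "complex \<times> complex \<Rightarrow> complex \<times> complex \<Rightarrow> complex \<times> complex \<Rightarrow> real"
  where "\<omega>_KB p X Y = g_KB p (complex_structure X) Y"

lemma vector_4:
  "(vector [a, b, c, d] :: 'a::zero^4) $ 1 = a" "(vector [a, b, c, d] :: 'a^4) $ 2 = b"
  "(vector [a, b, c, d] :: 'a^4) $ 3 = c" "(vector [a, b, c, d] :: 'a^4) $ 4 = d"
  unfolding vector_def by simp_all

lemma g_KB_expand:
  "g_KB (\<tau>, z) (a, b) (c, d) =
    ((Im \<tau> + (Im z)\<^sup>2) / (Im \<tau>)^3 * (Re a * Re c + Im a * Im c)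
     - Im z / (Im \<tau>)\<^sup>2 * (Re a * Re d + Im a * Im d + Re b * Re c + Im b * Im c)
     + (Re b * Re d + Im b * Im d) / Im \<tau>) / 2"
  by (simp add: g_KB_def KB_matrix_def real_coords_def Let_def inner_vec_def
      matrix_vector_mult_def sum_4 vector_4 algebra_simps add_divide_distrib diff_divide_distrib)

lemma \<omega>_KB_nondegenerate:
  assumes p: "p \<in> siegel_jacobi" and eq: "\<omega>_KB p X = \<omega>_KB p X'"
  shows "X = X'"
proof -
  obtain \<tau> z where pz: "p = (\<tau>, z)" and v: "Im \<tau> > 0"
    using p by (auto simp: siegel_jacobi_def)
  define W where "W = complex_structure (X - X')"
  obtain a b where W: "W = (a, b)" by (cases W)
  have "g_KB p (complex_structure (X - X')) W = \<omega>_KB p X W - \<omega>_KB p X' W"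
    by (cases X; cases X')
      (simp add: \<omega>_KB_def pz W g_KB_expand complex_structure_def algebra_simps
        add_divide_distrib diff_divide_distrib)
  hence 0: "g_KB p W W = 0" using eq by (simp add: W_def)
  have "g_KB p W W = ((Re a)\<^sup>2 + (Im a)\<^sup>2) / (2 * (Im \<tau>)\<^sup>2)
      + ((Re b - Im z * Re a / Im \<tau>)\<^sup>2 + (Im b - Im z * Im a / Im \<tau>)\<^sup>2) / (2 * Im \<tau>)"
    using v by (simp add: pz W g_KB_expand field_simps power2_eq_square power3_eq_cube)
  moreover have "((Re a)\<^sup>2 + (Im a)\<^sup>2) / (2 * (Im \<tau>)\<^sup>2) \<ge> 0"
    "((Re b - Im z * Re a / Im \<tau>)\<^sup>2 + (Im b - Im z * Im a / Im \<tau>)\<^sup>2) / (2 * Im \<tau>) \<ge> 0"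
    using v by auto
  ultimately have
    *: "((Re a)\<^sup>2 + (Im a)\<^sup>2) / (2 * (Im \<tau>)\<^sup>2) = 0"
      "((Re b - Im z * Re a / Im \<tau>)\<^sup>2 + (Im b - Im z * Im a / Im \<tau>)\<^sup>2) / (2 * Im \<tau>) = 0"
    using 0 by linarith+
  from *(1) v have a: "Re a = 0" "Im a = 0" by (auto simp: sum_power2_eq_zero_iff)
  with *(2) v have "Re b = 0" "Im b = 0" by (auto simp: sum_power2_eq_zero_iff)
  with a have "W = 0" by (simp add: W complex_eq_iff zero_prod_def)
  thus ?thesis by (auto simp: W_def complex_structure_def zero_prod_def prod_eq_iff)
qed

lemma hamiltonian_vector_field_siegel_jacobi:
  assumes "p \<in> siegel_jacobi" "(f has_derivative \<omega>_KB p X) (at p)"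
  shows "hamiltonian_vector_field \<omega>_KB f p = X"
  unfolding hamiltonian_vector_field_def
proof (rule the_equality)
  fix Y assume "(f has_derivative \<omega>_KB p Y) (at p)"
  with assms(2) have "\<omega>_KB p Y = \<omega>_KB p X" by (rule has_derivative_unique[rotated])
  thus "Y = X" by (rule \<omega>_KB_nondegenerate[OF assms(1)])
qed (rule assms(2))

definition \<theta>1 :: "complex \<times> complex \<Rightarrow> real" where "\<theta>1 p = Im (snd p)"
definition \<theta>2 :: "complex \<times> complex \<Rightarrow> real" where "\<theta>2 p = - Im (fst p)"
definition d\<theta>1 :: "complex \<times> complex \<Rightarrow> real" where "d\<theta>1 p = - Re (snd p)"
definition d\<theta>2 :: "complex \<times> complex \<Rightarrow> real" where "d\<theta>2 p = Re (fst p)"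

text \<open>\<open>d\<theta>1\<close> and \<open>d\<theta>2\<close> are the coordinates written with a dot.\<close>

lemma siegel_jacobi_coordinates:
  "\<tau> = d\<theta>2 (\<tau>, z) - \<i> * \<theta>2 (\<tau>, z)" "z = - d\<theta>1 (\<tau>, z) + \<i> * \<theta>1 (\<tau>, z)"
  "(\<tau>, z) \<in> siegel_jacobi \<longleftrightarrow> \<theta>2 (\<tau>, z) < 0"
  by (simp_all add: complex_eq_iff \<theta>1_def \<theta>2_def d\<theta>1_def d\<theta>2_def siegel_jacobi_def)

definition \<eta>1 :: "complex \<times> complex \<Rightarrow> real"
  where "\<eta>1 p = - \<theta>1 p / (2 * \<theta>2 p)"

definition \<eta>2 :: "complex \<times> complex \<Rightarrow> real"
  where "\<eta>2 p = ((\<theta>1 p)\<^sup>2 - 2 * \<theta>2 p) / (4 * (\<theta>2 p)\<^sup>2)"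


section \<open>The Jacobi group\<close>

definition \<Omega> :: "real^2 \<Rightarrow> real^2 \<Rightarrow> real"
  where "\<Omega> \<xi> \<eta> = \<xi>$1 * \<eta>$2 - \<xi>$2 * \<eta>$1"

definition jacobi_group :: "((real^2^2) \<times> (real^2) \<times> real) monoid"
  where "jacobi_group =
    \<lparr>carrier = {(M, X, \<kappa>). det M = 1},
     mult = (\<lambda>(M1, X1, \<kappa>1) (M2, X2, \<kappa>2).
       (M1 ** M2, X1 v* M2 + X2, \<kappa>1 + \<kappa>2 + \<Omega> (X1 v* M2) X2)),
     one = (mat 1, 0, 0)\<rparr>"

fun jacobi_act :: "(real^2^2) \<times> (real^2) \<times> real \<Rightarrow> complex \<times> complex \<Rightarrow> complex \<times> complex"
  where "jacobi_act (M, X, \<kappa>) (\<tau>, z) =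
    ((of_real (M$1$1) * \<tau> + of_real (M$1$2)) / (of_real (M$2$1) * \<tau> + of_real (M$2$2)),
     (z + of_real (X$1) * \<tau> + of_real (X$2)) / (of_real (M$2$1) * \<tau> + of_real (M$2$2)))"

lemma matrix_2_eq_iff:
  "(A :: 'a^2^2) = B \<longleftrightarrow> A$1$1 = B$1$1 \<and> A$1$2 = B$1$2 \<and> A$2$1 = B$2$1 \<and> A$2$2 = B$2$2"
  by (auto simp: vec_eq_iff forall_2)

lemma \<Omega>_mult_det_1:
  assumes "det M = 1"
  shows "\<Omega> (\<xi> v* M) (\<eta> v* M) = \<Omega> \<xi> \<eta>"
proof -
  have "\<Omega> (\<xi> v* M) (\<eta> v* M) = det M * \<Omega> \<xi> \<eta>"
    by (simp add: \<Omega>_def det_2 vector_matrix_mult_def sum_2 algebra_simps)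
  thus ?thesis using assms by simp
qed

lemma group_jacobi_group: "group jacobi_group"
proof (rule groupI)
  fix x assume "x \<in> carrier jacobi_group"
  then obtain M X \<kappa> where x: "x = (M, X, \<kappa>)" and M: "det M = 1"
    by (auto simp: jacobi_group_def)
  define N :: "real^2^2" where "N = vector [vector [M$2$2, - M$1$2], vector [- M$2$1, M$1$1]]"
  have N: "det N = 1" "N ** M = mat 1"
    using M by (simp_all add: N_def det_2 matrix_2_eq_iff matrix_matrix_mult_def sum_2 mat_def
        algebra_simps)
  have "\<Omega> (- X) X = 0" by (simp add: \<Omega>_def)
  moreover have "(- (X v* N)) v* M = - X"
  proof -
    have "(- (X v* N)) v* M = - ((X v* N) v* M)"
      by (simp add: vector_matrix_mult_def vec_eq_iff sum_negf)
    thus ?thesis by (simp add: vector_matrix_mul_assoc N(2))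
  qed
  ultimately show "\<exists>y\<in>carrier jacobi_group. y \<otimes>\<^bsub>jacobi_group\<^esub> x = \<one>\<^bsub>jacobi_group\<^esub>"
    using N by (intro bexI[of _ "(N, - (X v* N), - \<kappa>)"]) (auto simp: x jacobi_group_def)
next
  fix x y z assume "x \<in> carrier jacobi_group" "y \<in> carrier jacobi_group" "z \<in> carrier jacobi_group"
  then obtain M1 X1 k1 M2 X2 k2 M3 X3 k3
    where eqs: "x = (M1, X1, k1)" "y = (M2, X2, k2)" "z = (M3, X3, k3)" and "det M3 = 1"
    by (auto simp: jacobi_group_def)
  have add: "(a + b) v* M = a v* M + b v* M" for a b and M :: "real^2^2"
    by (simp add: vector_matrix_mult_def vec_eq_iff sum.distrib algebra_simps)
  have "\<Omega> (a + b) c = \<Omega> a c + \<Omega> b c" "\<Omega> a (b + c) = \<Omega> a b + \<Omega> a c" for a b c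
    by (simp_all add: \<Omega>_def algebra_simps)
  with \<Omega>_mult_det_1[OF \<open>det M3 = 1\<close>]
  show "x \<otimes>\<^bsub>jacobi_group\<^esub> y \<otimes>\<^bsub>jacobi_group\<^esub> z = x \<otimes>\<^bsub>jacobi_group\<^esub> (y \<otimes>\<^bsub>jacobi_group\<^esub> z)"
    by (simp add: eqs jacobi_group_def matrix_mul_assoc vector_matrix_mul_assoc[symmetric] add)
qed (auto simp: jacobi_group_def det_mul \<Omega>_def)

lemma jacobi_act_denominator:
  fixes M :: "real^2^2"
  assumes "det M = 1" "Im \<tau> > 0"
  shows "of_real (M$2$1) * \<tau> + of_real (M$2$2) \<noteq> (0::complex)"
  using assms by (auto simp: complex_eq_iff det_2)

lemma jacobi_act_closed:
  assumes "g \<in> carrier jacobi_group" "p \<in> siegel_jacobi"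
  shows "jacobi_act g p \<in> siegel_jacobi"
proof -
  obtain M X \<kappa> \<tau> z where eqs: "g = (M, X, \<kappa>)" "p = (\<tau>, z)" and M: "det M = 1" and v: "Im \<tau> > 0"
    using assms by (auto simp: jacobi_group_def siegel_jacobi_def)
  define w where "w = of_real (M$2$1) * \<tau> + of_real (M$2$2)"
  have w: "w \<noteq> 0" using jacobi_act_denominator[OF M v] by (simp add: w_def)
  have "Im ((of_real (M$1$1) * \<tau> + of_real (M$1$2)) / w) = det M * Im \<tau> / (cmod w)\<^sup>2"
    by (simp add: Im_divide cmod_power2) (simp add: w_def det_2 algebra_simps)
  also have "\<dots> > 0" using w v M by simp
  finally show ?thesis by (simp add: eqs siegel_jacobi_def w_def)
qed

lemma jacobi_act_one: "jacobi_act \<one>\<^bsub>jacobi_group\<^esub> p = p"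
  by (cases p) (simp add: jacobi_group_def mat_def)

lemma jacobi_act_mult:
  assumes "g \<in> carrier jacobi_group" "h \<in> carrier jacobi_group" "p \<in> siegel_jacobi"
  shows "jacobi_act (g \<otimes>\<^bsub>jacobi_group\<^esub> h) p = jacobi_act g (jacobi_act h p)"
proof -
  obtain M X \<kappa> N Y \<nu> \<tau> z where eqs: "g = (M, X, \<kappa>)" "h = (N, Y, \<nu>)" "p = (\<tau>, z)"
      and M: "det M = 1" and N: "det N = 1" and v: "Im \<tau> > 0"
    using assms by (auto simp: jacobi_group_def siegel_jacobi_def)
  have w: "of_real (N$2$1) * \<tau> + of_real (N$2$2) \<noteq> (0::complex)"
    by (rule jacobi_act_denominator[OF N v])
  have frac: "(a * (n / d) + b) / (c * (n / d) + e) = (a * n + b * d) / (c * n + e * d)"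
      "(m / d + a * (n / d) + b) / (c * (n / d) + e) = (m + a * n + b * d) / (c * n + e * d)"
    if "d \<noteq> 0" for a b c d e m n :: complex
  proof -
    have *: "c * (n / d) + e = (c * n + e * d) / d" "a * (n / d) + b = (a * n + b * d) / d"
      "m / d + a * (n / d) + b = (m + a * n + b * d) / d"
      using that by (simp_all add: add_divide_distrib)
    show "(a * (n / d) + b) / (c * (n / d) + e) = (a * n + b * d) / (c * n + e * d)"
      "(m / d + a * (n / d) + b) / (c * (n / d) + e) = (m + a * n + b * d) / (c * n + e * d)"
      unfolding * using that by simp_all
  qed
  show ?thesis
    by (simp only: eqs jacobi_group_def monoid.simps partial_object.simps prod.case
          jacobi_act.simps frac[OF w])
      (intro arg_cong2[of _ _ _ _ Pair] arg_cong2[of _ _ _ _ "(/)"];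
        simp add: matrix_matrix_mult_def vector_matrix_mult_def sum_2 algebra_simps)
qed


section \<open>The Lie algebra of the Jacobi group\<close>

typedef sl2 = "{A :: real^2^2. trace A = 0}" morphisms mat_of_sl2 Abs_sl2
  by (rule exI[of _ 0]) (simp add: trace_def)

setup_lifting type_definition_sl2

instantiation sl2 :: real_vector
begin

lift_definition zero_sl2 :: sl2 is 0 by (simp add: trace_def)
lift_definition plus_sl2 :: "sl2 \<Rightarrow> sl2 \<Rightarrow> sl2" is "(+)" by (simp add: trace_add)
lift_definition minus_sl2 :: "sl2 \<Rightarrow> sl2 \<Rightarrow> sl2" is "(-)" by (simp add: trace_sub)
lift_definition uminus_sl2 :: "sl2 \<Rightarrow> sl2" is uminus by (simp add: trace_def sum_negf)
lift_definition scaleR_sl2 :: "real \<Rightarrow> sl2 \<Rightarrow> sl2" is scaleR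
  by (simp add: trace_def flip: sum_distrib_left)

instance by standard (transfer; simp add: algebra_simps)+

end

instantiation sl2 :: real_inner
begin

lift_definition inner_sl2 :: "sl2 \<Rightarrow> sl2 \<Rightarrow> real" is inner .
lift_definition norm_sl2 :: "sl2 \<Rightarrow> real" is norm .

definition dist_sl2 :: "sl2 \<Rightarrow> sl2 \<Rightarrow> real" where "dist_sl2 x y = norm (x - y)"
definition sgn_sl2 :: "sl2 \<Rightarrow> sl2" where "sgn_sl2 x = x /\<^sub>R norm x"
definition uniformity_sl2 :: "(sl2 \<times> sl2) filter"
  where "uniformity_sl2 = (INF e\<in>{0<..}. principal {(x, y). dist x y < e})"
definition open_sl2 :: "sl2 set \<Rightarrow> bool"
  where "open_sl2 U \<longleftrightarrow> (\<forall>x\<in>U. \<forall>\<^sub>F (x', y) in uniformity. x' = x \<longrightarrow> y \<in> U)"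

instance
proof
  show "dist x y = norm (x - y)" for x y :: sl2 by (fact dist_sl2_def)
  show "sgn x = x /\<^sub>R norm x" for x :: sl2 by (fact sgn_sl2_def)
  show "uniformity = (INF e\<in>{0<..}. principal {(x :: sl2, y). dist x y < e})"
    by (fact uniformity_sl2_def)
  show "open U \<longleftrightarrow> (\<forall>x\<in>U. \<forall>\<^sub>F (x', y) in uniformity. x' = x \<longrightarrow> y \<in> U)" for U :: "sl2 set"
    by (fact open_sl2_def)
  show "inner x y = inner y x" for x y :: sl2 by transfer (rule inner_commute)
  show "inner (x + y) z = inner x z + inner y z" for x y z :: sl2
    by transfer (rule inner_add_left)
  show "inner (r *\<^sub>R x) y = r * inner x y" for r and x y :: sl2
    by transfer (rule inner_scaleR_left)
  show "0 \<le> inner x x" for x :: sl2 by transfer (rule inner_ge_zero)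
  show "inner x x = 0 \<longleftrightarrow> x = 0" for x :: sl2 by transfer (rule inner_eq_zero_iff)
  show "norm x = sqrt (inner x x)" for x :: sl2 by transfer (rule norm_eq_sqrt_inner)
qed

end

definition F_sl2 :: sl2 where "F_sl2 = Abs_sl2 (vector [vector [0, 1], vector [0, 0]])"
definition G_sl2 :: sl2 where "G_sl2 = Abs_sl2 (vector [vector [0, 0], vector [1, 0]])"
definition H_sl2 :: sl2 where "H_sl2 = Abs_sl2 (vector [vector [1, 0], vector [0, -1]])"

lemma mat_of_sl2_basis:
  "mat_of_sl2 F_sl2 = vector [vector [0, 1], vector [0, 0]]"
  "mat_of_sl2 G_sl2 = vector [vector [0, 0], vector [1, 0]]"
  "mat_of_sl2 H_sl2 = vector [vector [1, 0], vector [0, -1]]"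
  unfolding F_sl2_def G_sl2_def H_sl2_def
  by (subst Abs_sl2_inverse; simp add: trace_def sum_2)+

instantiation sl2 :: euclidean_space
begin

definition Basis_sl2 :: "sl2 set" where "Basis_sl2 = {F_sl2, G_sl2, (1 / sqrt 2) *\<^sub>R H_sl2}"

instance
proof
  have i: "inner F_sl2 F_sl2 = 1" "inner G_sl2 G_sl2 = 1" "inner H_sl2 H_sl2 = 2"
    "inner F_sl2 G_sl2 = 0" "inner F_sl2 H_sl2 = 0" "inner G_sl2 H_sl2 = 0"
    "inner G_sl2 F_sl2 = 0" "inner H_sl2 F_sl2 = 0" "inner H_sl2 G_sl2 = 0"
    by (simp_all add: inner_sl2.rep_eq mat_of_sl2_basis inner_vec_def sum_2)
  have ne: "F_sl2 \<noteq> G_sl2" "F_sl2 \<noteq> (1 / sqrt 2) *\<^sub>R H_sl2" "G_sl2 \<noteq> (1 / sqrt 2) *\<^sub>R H_sl2"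
    using i by (force dest: arg_cong[of _ _ "inner F_sl2"] arg_cong[of _ _ "inner G_sl2"])+
  show "Basis \<noteq> ({} :: sl2 set)" "finite (Basis :: sl2 set)" by (simp_all add: Basis_sl2_def)
  show "inner u v = (if u = v then 1 else 0)" if "u \<in> Basis" "v \<in> Basis" for u v :: sl2
    using that ne ne[symmetric] i by (auto simp: Basis_sl2_def)
  show "(\<forall>u\<in>Basis. inner x u = 0) \<longleftrightarrow> x = 0" for x :: sl2
  proof -
    have tr: "mat_of_sl2 x $ 1 $ 1 + mat_of_sl2 x $ 2 $ 2 = 0"
      using mat_of_sl2[of x] by (simp add: trace_def sum_2)
    have "inner x F_sl2 = mat_of_sl2 x $ 1 $ 2" "inner x G_sl2 = mat_of_sl2 x $ 2 $ 1"
      "inner x H_sl2 = mat_of_sl2 x $ 1 $ 1 - mat_of_sl2 x $ 2 $ 2"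
      by (simp_all add: inner_sl2.rep_eq mat_of_sl2_basis inner_vec_def sum_2)
    hence "(\<forall>u\<in>Basis. inner x u = 0) \<longleftrightarrow> mat_of_sl2 x = 0"
      using tr by (auto simp: Basis_sl2_def matrix_2_eq_iff)
    thus ?thesis by (simp add: mat_of_sl2_inject[symmetric] zero_sl2.rep_eq)
  qed
qed

end

text \<open>The triple \<open>(A, \<xi>, r)\<close> is the velocity at the identity of a curve in the group, in the given
  coordinates \<open>(M, X, \<kappa>)\<close>. Antisymmetrising the second-order part \<open>(AB, \<xi>B, \<Omega>(\<xi>, \<eta>))\<close> of the group
  law yields the bracket \<open>([A, B], \<xi>B - \<eta>A, 2\<Omega>(\<xi>, \<eta>))\<close>, so this is the Lie algebra with its
  usual coordinates.\<close>

type_synonym jacobi_algebra = "sl2 \<times> (real^2) \<times> real"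

definition jacobi_tangent :: "jacobi_algebra \<Rightarrow> (real^2^2) \<times> (real^2) \<times> real"
  where "jacobi_tangent = (\<lambda>(A, \<xi>, r). (mat_of_sl2 A, \<xi>, r))"

definition jF :: jacobi_algebra where "jF = (F_sl2, 0, 0)"
definition jG :: jacobi_algebra where "jG = (G_sl2, 0, 0)"
definition jH :: jacobi_algebra where "jH = (H_sl2, 0, 0)"
definition jP :: jacobi_algebra where "jP = (0, vector [1, 0], 0)"
definition jQ :: jacobi_algebra where "jQ = (0, vector [0, 1], 0)"
definition jR :: jacobi_algebra where "jR = (0, 0, 1)"

end

(* Left-invariant vector fields of the Jacobi group are affine in the coordinates (M, X, kappa), so
   one-parameter subgroups are exactly the solutions through the identity of an affine differential
   equation. This gives both uniqueness (Gronwall) and existence (closed form from A^2 = -det A).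
   Differentiating the action along them yields the fundamental vector fields, which are then
   compared with the derivative of psi(L), written explicitly in the coordinates u, v, x, y. *)
theory Submission
  imports Defs
begin

section \<open>Calculus of smooth maps\<close>

text \<open>The fields are affine because the group law is affine in its left factor. Both
  \<open>lie_exp\<close> and \<open>hamiltonian_vector_field\<close> are definite descriptions. The
  former becomes accessible once the homomorphism law is exchanged for a differential equation with
  exactly one solution; the latter does so through nondegeneracy of the form, so it suffices to
  exhibit d\<psi>(L) as the contraction of the form with the fundamental field. Since \<psi> and
  \<open>J\<close> are prescribed on an open set only, derivatives and smoothness are established
  for an explicit rational function and carried over by local agreement.\<close>

lemma frechet_derivative_eqI:
  "(f has_derivative f') (at x) \<Longrightarrow> frechet_derivative f (at x) = f'"
  by (rule frechet_derivative_at[symmetric])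

text \<open>On an open set the derivative at a point sees only nearby values, so the recursion never
  leaves \<open>S\<close>. This matters because \<psi> and \<open>J\<close> are arbitrary outside
  \<open>siegel_jacobi\<close>.\<close>

lemma diff_times_on_cong:
  assumes "open S" "\<And>x. x \<in> S \<Longrightarrow> f x = g x"
  shows "diff_times_on n S f \<longleftrightarrow> diff_times_on n S g"
proof -
  have "diff_times_on n S g"
    if "diff_times_on n S f" "\<And>x. x \<in> S \<Longrightarrow> f x = g x" for f g :: "'a \<Rightarrow> 'b"
    using that
  proof (induction n arbitrary: f g)
    case 0
    then show ?case using continuous_on_cong[of S S f g] by simp
  next
    case (Suc n)
    have d: "(g has_derivative frechet_derivative f (at x)) (at x)" if "x \<in> S" for x
    proof (rule has_derivative_transform_within_open[OF _ assms(1) that])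
      show "(f has_derivative frechet_derivative f (at x)) (at x)"
        using Suc.prems(1) that by (simp add: frechet_derivative_works)
    qed (simp add: Suc.prems(2))
    have "diff_times_on n S (\<lambda>x. frechet_derivative g (at x) v)" for v
    proof (rule Suc.IH)
      show "diff_times_on n S (\<lambda>x. frechet_derivative f (at x) v)"
        using Suc.prems(1) by simp
      show "frechet_derivative f (at x) v = frechet_derivative g (at x) v" if "x \<in> S" for x
        using frechet_derivative_eqI[OF d[OF that]] by simp
    qed
    moreover have "g differentiable (at x)" if "x \<in> S" for x
      using d[OF that] by (auto simp: differentiable_def)
    ultimately show ?case by simp
  qed
  from this[of f g] this[of g f] show ?thesis using assms(2) by auto
qed

text \<open>Lets any known family of derivatives replace the choice made by
  \<open>frechet_derivative\<close>; the inductions below step through it.\<close>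

lemma diff_times_on_SucI:
  assumes "open S" "\<And>x. x \<in> S \<Longrightarrow> (f has_derivative f' x) (at x)"
    and "\<And>v. diff_times_on n S (\<lambda>x. f' x v)"
  shows "diff_times_on (Suc n) S f"
proof -
  have "diff_times_on n S (\<lambda>x. frechet_derivative f (at x) v)" for v
    using assms(3)[of v] frechet_derivative_eqI[OF assms(2)]
    by (subst diff_times_on_cong[OF assms(1)]) auto
  with assms(2) show ?thesis by (auto simp: differentiable_def)
qed

lemma diff_times_on_SucD:
  assumes "diff_times_on (Suc n) S f"
  shows "diff_times_on n S f"
  using assms
proof (induction n arbitrary: f)
  case 0
  then show ?case
    by (auto intro!: continuous_at_imp_continuous_on differentiable_imp_continuous_within)
next
  case (Suc n)
  then show ?case by (metis diff_times_on.simps(2))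
qed

lemma diff_times_on_frechet:
  assumes "diff_times_on (Suc n) S f"
  shows "x \<in> S \<Longrightarrow> (f has_derivative frechet_derivative f (at x)) (at x)"
    and "diff_times_on n S (\<lambda>x. frechet_derivative f (at x) v)"
  using assms by (auto simp: frechet_derivative_works)

section \<open>Closure properties at finite order\<close>

lemma diff_times_on_const:
  assumes "open S"
  shows "diff_times_on n S (\<lambda>x. c)"
proof (induction n arbitrary: c)
  case (Suc n)
  show ?case by (rule diff_times_on_SucI[OF assms, where f' = "\<lambda>x v. 0"]) (auto intro: Suc)
qed simp

lemma diff_times_on_bounded_linear:
  assumes "open S" "bounded_linear h" "diff_times_on n S f"
  shows "diff_times_on n S (\<lambda>x. h (f x))"
  using assms(3)
proof (induction n arbitrary: f)
  case 0
  then show ?case using bounded_linear.continuous_on[OF assms(2)] by simp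
next
  case (Suc n)
  show ?case
    by (rule diff_times_on_SucI[OF assms(1)
          bounded_linear.has_derivative[OF assms(2) diff_times_on_frechet(1)[OF Suc.prems]]])
      (auto intro!: Suc.IH diff_times_on_frechet(2)[OF Suc.prems])
qed

lemma diff_times_on_add:
  assumes "open S" "diff_times_on n S f" "diff_times_on n S g"
  shows "diff_times_on n S (\<lambda>x. f x + g x)"
  using assms(2,3)
proof (induction n arbitrary: f g)
  case 0
  then show ?case by (simp add: continuous_on_add)
next
  case (Suc n)
  show ?case
    by (rule diff_times_on_SucI[OF assms(1) has_derivative_add[OF
          diff_times_on_frechet(1)[OF Suc.prems(1)] diff_times_on_frechet(1)[OF Suc.prems(2)]]])
      (auto intro!: Suc.IH diff_times_on_frechet(2) Suc.prems)
qed

text \<open>Each summand of the product rule keeps one factor undifferentiated;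
  \<open>diff_times_on_SucD\<close> lowers that factor to the order of the induction
  hypothesis.\<close>

lemma diff_times_on_mult:
  fixes f g :: "'a::real_normed_vector \<Rightarrow> 'b::real_normed_algebra"
  assumes "open S" "diff_times_on n S f" "diff_times_on n S g"
  shows "diff_times_on n S (\<lambda>x. f x * g x)"
  using assms(2,3)
proof (induction n arbitrary: f g)
  case 0
  then show ?case by (simp add: continuous_on_mult)
next
  case (Suc n)
  show ?case
    by (rule diff_times_on_SucI[OF assms(1) has_derivative_mult[OF
          diff_times_on_frechet(1)[OF Suc.prems(1)] diff_times_on_frechet(1)[OF Suc.prems(2)]]])
      (auto intro!: Suc.IH diff_times_on_add[OF assms(1)] diff_times_on_frechet(2) Suc.prems
        diff_times_on_SucD[OF Suc.prems(1)] diff_times_on_SucD[OF Suc.prems(2)]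
        simp del: diff_times_on.simps)
qed

text \<open>The derivative of 1/f contains 1/f again, but only at the lower order, where the
  induction hypothesis for the same f provides it.\<close>

lemma diff_times_on_inverse:
  fixes f :: "'a::real_normed_vector \<Rightarrow> real"
  assumes "open S" "diff_times_on n S f" "\<And>x. x \<in> S \<Longrightarrow> f x \<noteq> 0"
  shows "diff_times_on n S (\<lambda>x. inverse (f x))"
  using assms(2)
proof (induction n)
  case 0
  then show ?case using assms(3) by (simp add: continuous_on_inverse)
next
  case (Suc n)
  have "((\<lambda>x. inverse (f x)) has_derivative
      (\<lambda>v. (-1) * (inverse (f x) * frechet_derivative f (at x) v * inverse (f x)))) (at x)"
    if "x \<in> S" for x
    using Deriv.has_derivative_inverse[OF assms(3)[OF that] diff_times_on_frechet(1)[OF Suc.prems that]]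
    by simp
  then show ?case
  proof (rule diff_times_on_SucI[OF assms(1)])
    show "diff_times_on n S (\<lambda>x. (-1) * (inverse (f x) * frechet_derivative f (at x) v * inverse (f x)))"
      for v
      by (intro diff_times_on_mult diff_times_on_const assms(1) Suc.IH
          diff_times_on_SucD[OF Suc.prems] diff_times_on_frechet(2)[OF Suc.prems])
  qed
qed

section \<open>Closure properties of smooth maps\<close>

lemma smooth_on_cong:
  assumes "smooth_on S f" "\<And>x. x \<in> S \<Longrightarrow> f x = g x"
  shows "smooth_on S g"
  using assms diff_times_on_cong[of S f g] by (auto simp: smooth_on_def)

lemma smooth_on_const: "open S \<Longrightarrow> smooth_on S (\<lambda>x. c)"
  by (simp add: smooth_on_def diff_times_on_const)

lemma smooth_on_id:
  assumes "open S"
  shows "smooth_on S (\<lambda>x. x)"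
  unfolding smooth_on_def
proof (intro conjI allI assms)
  fix n
  show "diff_times_on n S (\<lambda>x. x)"
  proof (cases n)
    case (Suc m)
    show ?thesis unfolding Suc
      by (rule diff_times_on_SucI[OF assms has_derivative_ident]) (rule diff_times_on_const[OF assms])
  qed simp
qed

lemma smooth_on_bounded_linear:
  "bounded_linear h \<Longrightarrow> smooth_on S f \<Longrightarrow> smooth_on S (\<lambda>x. h (f x))"
  by (simp add: smooth_on_def diff_times_on_bounded_linear)

lemma smooth_on_add: "smooth_on S f \<Longrightarrow> smooth_on S g \<Longrightarrow> smooth_on S (\<lambda>x. f x + g x)"
  by (simp add: smooth_on_def diff_times_on_add)

lemma smooth_on_minus: "smooth_on S f \<Longrightarrow> smooth_on S (\<lambda>x. - f x)"
  by (rule smooth_on_bounded_linear[OF bounded_linear_minus[OF bounded_linear_ident]])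

lemma smooth_on_diff: "smooth_on S f \<Longrightarrow> smooth_on S g \<Longrightarrow> smooth_on S (\<lambda>x. f x - g x)"
  using smooth_on_add[of S f "\<lambda>x. - g x"] smooth_on_minus[of S g] by simp

lemma smooth_on_mult:
  fixes f g :: "'a::real_normed_vector \<Rightarrow> 'b::real_normed_algebra"
  shows "smooth_on S f \<Longrightarrow> smooth_on S g \<Longrightarrow> smooth_on S (\<lambda>x. f x * g x)"
  by (simp add: smooth_on_def diff_times_on_mult)

lemma smooth_on_divide:
  fixes f g :: "'a::real_normed_vector \<Rightarrow> real"
  assumes "smooth_on S f" "smooth_on S g" "\<And>x. x \<in> S \<Longrightarrow> g x \<noteq> 0"
  shows "smooth_on S (\<lambda>x. f x / g x)"
  using assms unfolding divide_inverse
  by (intro smooth_on_mult) (auto simp: smooth_on_def diff_times_on_inverse)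

lemma smooth_on_sum:
  assumes "open S" "\<And>i. i \<in> I \<Longrightarrow> smooth_on S (f i)"
  shows "smooth_on S (\<lambda>x. \<Sum>i\<in>I. f i x)"
  using assms(2)
  by (induction I rule: infinite_finite_induct) (auto intro: smooth_on_const smooth_on_add assms(1))

text \<open>In finite dimension J(x) is the sum over the basis of J(x)(b) times the functional <b,
  .>. Each summand is a fixed bounded linear image of one coordinate function, so the operator norm
  need not be estimated.\<close>

lemma smooth_on_blinfun:
  fixes J :: "'a::real_normed_vector \<Rightarrow> 'b::euclidean_space \<Rightarrow>\<^sub>L 'c::real_normed_vector"
  assumes "open S" "\<And>b. b \<in> Basis \<Longrightarrow> smooth_on S (\<lambda>x. blinfun_apply (J x) b)"
  shows "smooth_on S J"
proof (rule smooth_on_cong)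
  have *: "bounded_linear (\<lambda>c. blinfun_scaleR_left c o\<^sub>L blinfun_inner_left b)" for b :: 'b
    by (rule bounded_linear_compose[OF
        bounded_bilinear.bounded_linear_left[OF bounded_bilinear_blinfun_compose]
        bounded_linear_blinfun_scaleR_left])
  show "smooth_on S (\<lambda>x. \<Sum>b\<in>Basis. blinfun_scaleR_left (blinfun_apply (J x) b) o\<^sub>L blinfun_inner_left b)"
    by (rule smooth_on_sum[OF assms(1)]) (rule smooth_on_bounded_linear[OF * assms(2)])
  show "(\<Sum>b\<in>Basis. blinfun_scaleR_left (blinfun_apply (J x) b) o\<^sub>L blinfun_inner_left b) = J x" for x
  proof (rule blinfun_euclidean_eqI)
    fix i :: 'b assume i: "i \<in> Basis"
    have "blinfun_apply (\<Sum>b\<in>Basis. blinfun_scaleR_left (blinfun_apply (J x) b) o\<^sub>L blinfun_inner_left b) i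
        = (\<Sum>b\<in>Basis. (i \<bullet> b) *\<^sub>R blinfun_apply (J x) b)"
      by (simp add: blinfun.sum_left inner_commute)
    also have "\<dots> = (\<Sum>b\<in>Basis. if i = b then blinfun_apply (J x) b else 0)"
      by (rule sum.cong) (simp_all add: inner_Basis[OF i])
    also have "\<dots> = blinfun_apply (J x) i" using i by simp
    finally show "blinfun_apply (\<Sum>b\<in>Basis. blinfun_scaleR_left (blinfun_apply (J x) b) o\<^sub>L blinfun_inner_left b) i
        = blinfun_apply (J x) i" .
  qed
qed


section \<open>Affine autonomous differential equations\<close>

text \<open>Bootstrapping: if f has order n, so does its derivative T f + b, and f gains one
  order.\<close>

lemma smooth_on_affine_ode:
  fixes f :: "real \<Rightarrow> 'a::real_normed_vector"
  assumes "bounded_linear T" "\<And>t. (f has_vector_derivative T (f t) + b) (at t)"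
  shows "smooth_on UNIV f"
  unfolding smooth_on_def
proof (intro conjI allI open_UNIV)
  fix n
  show "diff_times_on n UNIV f"
  proof (induction n)
    case 0
    show ?case using assms(2)
      by (auto intro!: continuous_at_imp_continuous_on has_vector_derivative_continuous)
  next
    case (Suc n)
    show ?case
      by (rule diff_times_on_SucI[OF open_UNIV assms(2)[unfolded has_vector_derivative_def]])
        (intro diff_times_on_bounded_linear[OF open_UNIV bounded_linear_scaleR_right]
          diff_times_on_add diff_times_on_const diff_times_on_bounded_linear[OF open_UNIV assms(1)]
          open_UNIV Suc)
  qed
qed

text \<open>The difference w solves w' = T w. The inner product makes \<phi> = |w|^2 differentiable,
  with |\<phi>'| \<le> 2K\<phi>.\<close>

lemma affine_ode_unique:
  fixes f g :: "real \<Rightarrow> 'a::real_inner"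
  assumes T: "bounded_linear T"
    and f: "\<And>t. (f has_vector_derivative T (f t) + b) (at t)"
    and g: "\<And>t. (g has_vector_derivative T (g t) + b) (at t)"
    and init: "f 0 = g 0"
  shows "f = g"
proof
  fix t
  define w where "w t = f t - g t" for t
  define \<phi> where "\<phi> t = w t \<bullet> w t" for t
  interpret T: bounded_linear T by (rule T)
  obtain K where K: "\<And>x. norm (T x) \<le> norm x * K" using T.bounded by blast
  have w: "(w has_vector_derivative T (w t)) (at t)" for t
    unfolding w_def using has_vector_derivative_diff[OF f g, of t] by (simp add: T.diff)
  have \<phi>: "(\<phi> has_real_derivative 2 * (w t \<bullet> T (w t))) (at t)" for t
    using bounded_bilinear.has_vector_derivative[OF bounded_bilinear_inner w w, of t]
    by (simp add: \<phi>_def[abs_def] has_real_derivative_iff_has_vector_derivative inner_commute)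
  have bound: "\<bar>w t \<bullet> T (w t)\<bar> \<le> K * \<phi> t" for t
  proof -
    have "\<bar>w t \<bullet> T (w t)\<bar> \<le> norm (w t) * norm (T (w t))" by (rule Cauchy_Schwarz_ineq2)
    also have "\<dots> \<le> norm (w t) * (norm (w t) * K)" by (intro mult_left_mono K) simp
    finally show ?thesis by (simp add: \<phi>_def power2_norm_eq_inner[symmetric] power2_eq_square mult_ac)
  qed
  \<comment> \<open>Used with k = -2K forward in time, where the product is nonincreasing, and with
    k = 2K on negative times, where it is nondecreasing; both times it is compared with \<phi> 0 =
    0.\<close>
  have d: "((\<lambda>t. exp (k * t) * \<phi> t) has_real_derivative
      exp (k * t) * (k * \<phi> t + 2 * (w t \<bullet> T (w t)))) (at t)" for k t
    by (rule derivative_eq_intros \<phi> refl | simp add: algebra_simps)+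
  have "\<phi> t \<le> 0"
  proof (cases "t \<ge> 0")
    case True
    have "exp (- 2 * K * t) * \<phi> t \<le> exp (- 2 * K * 0) * \<phi> 0"
    proof (rule DERIV_nonpos_imp_nonincreasing[OF True])
      fix x
      have "exp (- 2 * K * x) * (- 2 * K * \<phi> x + 2 * (w x \<bullet> T (w x))) \<le> 0"
        using bound[of x] by (intro mult_nonneg_nonpos) auto
      then show "\<exists>y. ((\<lambda>t. exp (- 2 * K * t) * \<phi> t) has_real_derivative y) (at x) \<and> y \<le> 0"
        using d by blast
    qed
    then show ?thesis using init by (simp add: \<phi>_def w_def mult_le_0_iff)
  next
    case False
    then have "t \<le> 0" by simp
    have "exp (2 * K * t) * \<phi> t \<le> exp (2 * K * 0) * \<phi> 0"
    proof (rule DERIV_nonneg_imp_nondecreasing[OF \<open>t \<le> 0\<close>])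
      fix x
      have "exp (2 * K * x) * (2 * K * \<phi> x + 2 * (w x \<bullet> T (w x))) \<ge> 0"
        using bound[of x] by (intro mult_nonneg_nonneg) auto
      then show "\<exists>y. ((\<lambda>t. exp (2 * K * t) * \<phi> t) has_real_derivative y) (at x) \<and> 0 \<le> y"
        using d by blast
    qed
    then show ?thesis using init by (simp add: \<phi>_def w_def mult_le_0_iff)
  qed
  then show "f t = g t"
    using inner_eq_zero_iff[of "w t"] inner_ge_zero[of "w t"]
    by (simp add: \<phi>_def) (simp add: w_def)
qed

text \<open>\<open>s\<close> solves s'' = \<delta> s with s(0) = 0 and s'(0) = 1; \<open>C\<close>
  and \<open>D\<close> are its first and second integrals from 0. Writing cosh as 1 + \<delta> C
  avoids division by \<delta>, so the parabolic, hyperbolic and elliptic cases share one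
  interface.\<close>

lemma integrated_hyperbolic_functions_exist:
  fixes \<delta> :: real
  obtains D C s :: "real \<Rightarrow> real" where
    "\<And>t. (D has_real_derivative C t) (at t)" "\<And>t. (C has_real_derivative s t) (at t)"
    "\<And>t. (s has_real_derivative 1 + \<delta> * C t) (at t)" "D 0 = 0" "C 0 = 0" "s 0 = 0"
proof -
  consider "\<delta> = 0" | "\<delta> > 0" | "\<delta> < 0" by linarith
  then show thesis
  proof cases
    case 1
    show thesis
      by (rule that[of "\<lambda>t. t ^ 3 / 6" "\<lambda>t. t ^ 2 / 2" "\<lambda>t. t"])
        (auto intro!: derivative_eq_intros simp: 1 power2_eq_square)
  next
    case 2
    define w where "w = sqrt \<delta>"
    have w: "w \<noteq> 0" "\<delta> = w * w" using 2 by (auto simp: w_def)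
    show thesis
      by (rule that[of "\<lambda>t. (sinh (w * t) / w - t) / \<delta>" "\<lambda>t. (cosh (w * t) - 1) / \<delta>"
            "\<lambda>t. sinh (w * t) / w"])
        (auto intro!: derivative_eq_intros simp: w field_simps)
  next
    case 3
    define w where "w = sqrt (- \<delta>)"
    have w: "w \<noteq> 0" "\<delta> = - (w * w)" using 3 by (auto simp: w_def)
    show thesis
      by (rule that[of "\<lambda>t. (sin (w * t) / w - t) / \<delta>" "\<lambda>t. (cos (w * t) - 1) / \<delta>"
            "\<lambda>t. sin (w * t) / w"])
        (auto intro!: derivative_eq_intros simp: w field_simps)
  qed
qed


section \<open>One-parameter subgroups of the Jacobi group\<close>

lemma bounded_bilinear_matrix_mult:
  "bounded_bilinear ((**) :: real^'n^'m \<Rightarrow> real^'k^'n \<Rightarrow> real^'k^'m)"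
  unfolding bilinear_conv_bounded_bilinear[symmetric] bilinear_def
  by (auto intro!: linearI simp: matrix_matrix_mult_def vec_eq_iff sum.distrib sum_distrib_left
      algebra_simps)

lemma bounded_bilinear_vector_matrix_mult:
  "bounded_bilinear ((v*) :: real^'m \<Rightarrow> real^'n^'m \<Rightarrow> real^'n)"
  unfolding bilinear_conv_bounded_bilinear[symmetric] bilinear_def
  by (auto intro!: linearI simp: vector_matrix_mult_def vec_eq_iff sum.distrib sum_distrib_left
      algebra_simps)

lemma bounded_bilinear_Omega: "bounded_bilinear \<Omega>"
  unfolding bilinear_conv_bounded_bilinear[symmetric] bilinear_def
  by (auto intro!: linearI simp: \<Omega>_def algebra_simps)

interpretation matrix_mult: bounded_bilinear "(**) :: real^'n^'m \<Rightarrow> real^'k^'n \<Rightarrow> real^'k^'m"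
  by (rule bounded_bilinear_matrix_mult)
interpretation vector_matrix_mult: bounded_bilinear "(v*) :: real^'m \<Rightarrow> real^'n^'m \<Rightarrow> real^'n"
  by (rule bounded_bilinear_vector_matrix_mult)
interpretation Omega: bounded_bilinear \<Omega>
  by (rule bounded_bilinear_Omega)

section \<open>Identities for \<Omega> and for trace-free matrices\<close>

lemma Omega_self [simp]: "\<Omega> \<xi> \<xi> = 0"
  by (simp add: \<Omega>_def)

text \<open>Infinitesimal form of the invariance of \<Omega> under determinant 1; it makes the
  central coordinate compatible with left translation.\<close>

lemma Omega_sl2_skew:
  assumes "trace A = 0"
  shows "\<Omega> (\<xi> v* A) \<zeta> + \<Omega> \<xi> (\<zeta> v* A) = 0"
proof -
  have "\<Omega> (\<xi> v* A) \<zeta> + \<Omega> \<xi> (\<zeta> v* A) = trace A * \<Omega> \<xi> \<zeta>"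
    by (simp add: \<Omega>_def vector_matrix_mult_def sum_2 trace_def algebra_simps)
  then show ?thesis using assms by simp
qed

lemma has_vector_derivative_matrix_entry:
  assumes "(M has_vector_derivative M') F"
  shows "((\<lambda>t. M t $ i $ j) has_vector_derivative M' $ i $ j) F"
  by (intro bounded_linear.has_vector_derivative[OF bounded_linear_vec_nth] assms)

lemma trace_mat_of_sl2: "trace (mat_of_sl2 A) = 0"
  using mat_of_sl2[of A] by simp

lemma mat_of_sl2_trace_free: "mat_of_sl2 A $ 2 $ 2 = - mat_of_sl2 A $ 1 $ 1"
  using trace_mat_of_sl2[of A] by (simp add: trace_def sum_2)

text \<open>Cayley-Hamilton for trace 0.\<close>

lemma sl2_square:
  "mat_of_sl2 A ** mat_of_sl2 A = (- det (mat_of_sl2 A)) *\<^sub>R mat 1"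
  by (simp add: mat_of_sl2_trace_free matrix_2_eq_iff matrix_matrix_mult_def sum_2 mat_def det_2
      algebra_simps)

text \<open>Trace 0 removes the mixed term. With c the generalised cosh, the right-hand side is the
  quantity conserved along the flow.\<close>

lemma det_sl2_pencil:
  "det (c *\<^sub>R mat 1 + s *\<^sub>R mat_of_sl2 A) = c\<^sup>2 + det (mat_of_sl2 A) * s\<^sup>2"
  by (simp add: mat_of_sl2_trace_free mat_def det_2 algebra_simps power2_eq_square)

text \<open>The derivative at the identity of left multiplication by \<open>(M, X, \<kappa>)\<close> sends the tangent
  vector \<open>L\<close> to \<open>jacobi_field_linear L (M, X, \<kappa>) + jacobi_field_const L\<close>.\<close>

fun jacobi_field_linear ::
    "jacobi_algebra \<Rightarrow> (real^2^2) \<times> (real^2) \<times> real \<Rightarrow> (real^2^2) \<times> (real^2) \<times> real"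
  where "jacobi_field_linear (A, \<xi>, r) (M, X, \<kappa>) = (M ** mat_of_sl2 A, X v* mat_of_sl2 A, \<Omega> X \<xi>)"

fun jacobi_field_const :: "jacobi_algebra \<Rightarrow> (real^2^2) \<times> (real^2) \<times> real"
  where "jacobi_field_const (A, \<xi>, r) = (0, \<xi>, r)"

text \<open>Integral curves of the left-invariant field of \<open>L\<close>. The initial value is
  left free so that left translates of such a curve are again of this kind.\<close>

definition jacobi_flow ::
    "jacobi_algebra \<Rightarrow> (real \<Rightarrow> (real^2^2) \<times> (real^2) \<times> real) \<Rightarrow> bool"
  where "jacobi_flow L \<gamma> \<longleftrightarrow>
    (\<forall>t. (\<gamma> has_vector_derivative jacobi_field_linear L (\<gamma> t) + jacobi_field_const L) (at t))"

lemma bounded_linear_jacobi_field: "bounded_linear (jacobi_field_linear L)"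
proof -
  obtain A \<xi> r where L: "L = (A, \<xi>, r)" by (cases L)
  show ?thesis unfolding linear_conv_bounded_linear[symmetric]
    by (rule linearI) (auto simp: L matrix_mult.add_left matrix_mult.scaleR_left
        vector_matrix_mult.add_left vector_matrix_mult.scaleR_left Omega.add_left Omega.scaleR_left)
qed

lemma jacobi_field_one:
  "jacobi_field_linear L \<one>\<^bsub>jacobi_group\<^esub> + jacobi_field_const L = jacobi_tangent L"
  by (cases L) (simp add: jacobi_group_def jacobi_tangent_def Omega.zero_left)

lemma jacobi_flow_unique:
  "jacobi_flow L \<gamma> \<Longrightarrow> jacobi_flow L \<gamma>' \<Longrightarrow> \<gamma> 0 = \<gamma>' 0 \<Longrightarrow> \<gamma> = \<gamma>'"
  unfolding jacobi_flow_def by (blast intro: affine_ode_unique[OF bounded_linear_jacobi_field])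

lemma smooth_on_jacobi_flow: "jacobi_flow L \<gamma> \<Longrightarrow> smooth_on UNIV \<gamma>"
  unfolding jacobi_flow_def by (blast intro: smooth_on_affine_ode[OF bounded_linear_jacobi_field])

lemma has_vector_derivative_fst_snd:
  assumes "(\<gamma> has_vector_derivative (M', X', \<kappa>')) F"
  shows "((\<lambda>t. fst (\<gamma> t)) has_vector_derivative M') F"
    "((\<lambda>t. fst (snd (\<gamma> t))) has_vector_derivative X') F"
    "((\<lambda>t. snd (snd (\<gamma> t))) has_vector_derivative \<kappa>') F"
  using bounded_linear.has_vector_derivative[OF bounded_linear_fst assms]
    bounded_linear.has_vector_derivative[OF bounded_linear_fst
      bounded_linear.has_vector_derivative[OF bounded_linear_snd assms]]
    bounded_linear.has_vector_derivative[OF bounded_linear_snd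
      bounded_linear.has_vector_derivative[OF bounded_linear_snd assms]]
  by simp_all

section \<open>Integral curves: left translation, rescaling, existence\<close>

text \<open>Serves both to translate integral curves and, at time 0, to differentiate the
  homomorphism law.\<close>

lemma has_vector_derivative_jacobi_mult:
  assumes "(\<gamma> has_vector_derivative (M', X', \<kappa>')) (at t)"
  shows "((\<lambda>s. (M, X, \<kappa>) \<otimes>\<^bsub>jacobi_group\<^esub> \<gamma> s) has_vector_derivative
    (M ** M', X v* M' + X', \<kappa>' + \<Omega> (X v* M') (fst (snd (\<gamma> t))) + \<Omega> (X v* fst (\<gamma> t)) X')) (at t)"
proof -
  note d = has_vector_derivative_fst_snd[OF assms]
  note XM = bounded_linear.has_vector_derivative[OF vector_matrix_mult.bounded_linear_right d(1), of X]
  have "((\<lambda>s. (M ** fst (\<gamma> s), X v* fst (\<gamma> s) + fst (snd (\<gamma> s)),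
        \<kappa> + snd (snd (\<gamma> s)) + \<Omega> (X v* fst (\<gamma> s)) (fst (snd (\<gamma> s)))))
      has_vector_derivative
      (M ** M', X v* M' + X', (0 + \<kappa>') + (\<Omega> (X v* fst (\<gamma> t)) X' + \<Omega> (X v* M') (fst (snd (\<gamma> t)))))) (at t)"
    by (intro has_vector_derivative_Pair has_vector_derivative_add has_vector_derivative_const d
        bounded_linear.has_vector_derivative[OF matrix_mult.bounded_linear_right]
        XM Omega.has_vector_derivative)
  then show ?thesis
    by (simp add: jacobi_group_def case_prod_beta' algebra_simps)
qed

lemma jacobi_flow_left_mult:
  assumes "jacobi_flow L \<gamma>"
  shows "jacobi_flow L (\<lambda>s. g \<otimes>\<^bsub>jacobi_group\<^esub> \<gamma> s)"
  unfolding jacobi_flow_def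
proof
  fix t
  obtain A \<xi> r where L: "L = (A, \<xi>, r)" by (cases L)
  obtain M X \<kappa> where g: "g = (M, X, \<kappa>)" by (cases g)
  obtain N Y \<nu> where \<gamma>: "\<gamma> t = (N, Y, \<nu>)" by (cases "\<gamma> t")
  let ?A = "mat_of_sl2 A"
  have "(\<gamma> has_vector_derivative (N ** ?A, Y v* ?A + \<xi>, \<Omega> Y \<xi> + r)) (at t)"
    using assms by (auto simp: jacobi_flow_def L \<gamma> dest: spec[of _ t])
  note has_vector_derivative_jacobi_mult[OF this, of M X \<kappa>]
  \<comment> \<open>The \<kappa>-component has to become
    \<open>\<Omega> (X v* N + Y) \<xi> + r\<close>; the product rule yields two further terms, which
    cancel.\<close>
  moreover have "\<Omega> (X v* N v* ?A) Y + \<Omega> (X v* N) (Y v* ?A) = 0"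
    by (rule Omega_sl2_skew[OF trace_mat_of_sl2])
  ultimately show "((\<lambda>s. g \<otimes>\<^bsub>jacobi_group\<^esub> \<gamma> s) has_vector_derivative
      jacobi_field_linear L (g \<otimes>\<^bsub>jacobi_group\<^esub> \<gamma> t) + jacobi_field_const L) (at t)"
    by (simp add: g L \<gamma> jacobi_group_def matrix_mul_assoc vector_matrix_mul_assoc
        vector_matrix_mult.add_left Omega.add_left Omega.add_right algebra_simps)
qed

text \<open>The field is linear in \<open>L\<close>, so a change of speed by c gives a curve for c
  L; one curve through the identity thus encodes the exponential on a whole line.\<close>

lemma jacobi_flow_scale:
  assumes "jacobi_flow L \<gamma>"
  shows "jacobi_flow (c *\<^sub>R L) (\<lambda>t. \<gamma> (c * t))"
  unfolding jacobi_flow_def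
proof
  fix t
  have "((\<lambda>t. c * t) has_vector_derivative c) (at t)"
    by (auto intro!: derivative_eq_intros)
  moreover have "(\<gamma> has_vector_derivative jacobi_field_linear L (\<gamma> (c * t)) + jacobi_field_const L)
      (at (c * t))"
    using assms by (simp add: jacobi_flow_def)
  ultimately have "((\<lambda>t. \<gamma> (c * t)) has_vector_derivative
      c *\<^sub>R (jacobi_field_linear L (\<gamma> (c * t)) + jacobi_field_const L)) (at t)"
    using vector_diff_chain_at[of "\<lambda>t. c * t" c t \<gamma>] by (simp add: o_def)
  moreover have "c *\<^sub>R (jacobi_field_linear L p + jacobi_field_const L) =
      jacobi_field_linear (c *\<^sub>R L) p + jacobi_field_const (c *\<^sub>R L)" for p
    by (cases L; cases p) (simp add: scaleR_sl2.rep_eq matrix_mult.scaleR_right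
        vector_matrix_mult.scaleR_right Omega.scaleR_right algebra_simps)
  ultimately show "((\<lambda>t. \<gamma> (c * t)) has_vector_derivative
      jacobi_field_linear (c *\<^sub>R L) (\<gamma> (c * t)) + jacobi_field_const (c *\<^sub>R L)) (at t)"
    by simp
qed

text \<open>Since \<open>A\<^sup>2 = \<delta> \<cdot> 1\<close> for \<open>\<delta> = - det A\<close>, the flow through the identity is a combination of
  \<open>1\<close>, \<open>A\<close> whose coefficients are the hyperbolic functions and their iterated integrals.\<close>

lemma jacobi_flow_exists:
  obtains \<gamma> where "jacobi_flow L \<gamma>" "\<gamma> 0 = \<one>\<^bsub>jacobi_group\<^esub>" "range \<gamma> \<subseteq> carrier jacobi_group"
proof -
  obtain A \<xi> r where L: "L = (A, \<xi>, r)" by (cases L)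
  define B where "B = mat_of_sl2 A"
  define \<delta> where "\<delta> = - det B"
  have BB: "B ** B = \<delta> *\<^sub>R mat 1" unfolding B_def \<delta>_def by (rule sl2_square)
  obtain D C s where
    D: "\<And>t. (D has_real_derivative C t) (at t)" and C: "\<And>t. (C has_real_derivative s t) (at t)" and
    s: "\<And>t. (s has_real_derivative 1 + \<delta> * C t) (at t)" and 0: "D 0 = 0" "C 0 = 0" "s 0 = 0"
    using integrated_hyperbolic_functions_exist[of \<delta>] by metis
  \<comment> \<open>\<open>M t\<close> is exp(tB), reduced by B^2 = \<delta>. \<open>X t\<close> is
    the integral of \<xi> exp(tB): 1 + \<delta> C integrates to s, and s to C. Since
    \<open>\<Omega> \<xi> \<xi> = 0\<close>, only the C-part of \<open>X t\<close> contributes to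
    \<open>\<Omega> (X t) \<xi>\<close>, and it integrates to the D-term of \<kappa>.\<close>
  define M where "M t = (1 + \<delta> * C t) *\<^sub>R mat 1 + s t *\<^sub>R B" for t
  define X where "X t = s t *\<^sub>R \<xi> + C t *\<^sub>R (\<xi> v* B)" for t
  define \<kappa> where "\<kappa> t = r * t + D t * \<Omega> (\<xi> v* B) \<xi>" for t
  have M: "(M has_vector_derivative M t ** B) (at t)" for t
  proof -
    have "(M has_vector_derivative (\<delta> * s t) *\<^sub>R mat 1 + (1 + \<delta> * C t) *\<^sub>R B) (at t)"
      unfolding M_def[abs_def]
      by (rule derivative_eq_intros C s refl | simp add: has_real_derivative_iff_has_vector_derivative[symmetric])+
    then show ?thesis
      by (simp add: M_def matrix_mult.add_left matrix_mult.scaleR_left BB algebra_simps)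
  qed
  have X: "(X has_vector_derivative X t v* B + \<xi>) (at t)" for t
  proof -
    have "(X has_vector_derivative (1 + \<delta> * C t) *\<^sub>R \<xi> + s t *\<^sub>R (\<xi> v* B)) (at t)"
      unfolding X_def[abs_def]
      by (rule derivative_eq_intros C s refl | simp add: has_real_derivative_iff_has_vector_derivative[symmetric])+
    then show ?thesis
      by (simp add: X_def vector_matrix_mult.add_left vector_matrix_mult.scaleR_left
          vector_matrix_mul_assoc BB vector_matrix_mult.scaleR_right algebra_simps)
  qed
  have \<kappa>: "(\<kappa> has_vector_derivative \<Omega> (X t) \<xi> + r) (at t)" for t
    unfolding has_real_derivative_iff_has_vector_derivative[symmetric] \<kappa>_def[abs_def]
    by (rule derivative_eq_intros D refl | simp add: X_def Omega.add_left Omega.scaleR_left)+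
  have flow: "jacobi_flow L (\<lambda>t. (M t, X t, \<kappa> t))"
    using has_vector_derivative_Pair[OF M has_vector_derivative_Pair[OF X \<kappa>]]
    by (simp add: jacobi_flow_def L B_def)
  have "det (M t) = 1" for t
  proof -
    \<comment> \<open>This is cosh^2 - sinh^2 in a form valid for every \<delta>: the two parts of
      its derivative are 2\<delta> s (1 + \<delta> C) with opposite signs.\<close>
    define f where "f t = (1 + \<delta> * C t)\<^sup>2 - \<delta> * (s t)\<^sup>2" for t
    have "(f has_real_derivative 0) (at x)" for x
      unfolding f_def[abs_def]
      by (rule derivative_eq_intros C s refl | simp)+
    then have "f t = f 0" by (rule DERIV_isconst_all[rule_format])
    then show ?thesis using det_sl2_pencil[of "1 + \<delta> * C t" "s t" A]
      by (simp add: M_def B_def[symmetric] f_def 0 \<delta>_def)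
  qed
  then show thesis
    using that[OF flow] by (auto simp: jacobi_group_def M_def X_def \<kappa>_def 0)
qed

text \<open>Differentiating \<gamma>(t + s) = \<gamma>(t) \<gamma>(s) at s = 0 gives the equation.
  Conversely, \<gamma>(s + t) and \<gamma>(s) \<gamma>(t), as functions of t, solve the same
  autonomous equation and start at the same point.\<close>

lemma one_parameter_subgroup_iff_flow:
  "one_parameter_subgroup jacobi_group jacobi_tangent L \<gamma> \<longleftrightarrow>
    jacobi_flow L \<gamma> \<and> \<gamma> 0 = \<one>\<^bsub>jacobi_group\<^esub>"
proof
  interpret group jacobi_group by (rule group_jacobi_group)
  assume *: "one_parameter_subgroup jacobi_group jacobi_tangent L \<gamma>"
  then have hom: "\<gamma> (s + t) = \<gamma> s \<otimes>\<^bsub>jacobi_group\<^esub> \<gamma> t"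
    and d: "(\<gamma> has_vector_derivative jacobi_tangent L) (at 0)"
    and car: "\<gamma> t \<in> carrier jacobi_group" for s t
    by (auto simp: one_parameter_subgroup_def)
  \<comment> \<open>\<open>\<gamma> 0\<close> is idempotent, hence the identity by
    cancellation.\<close>
  have one: "\<gamma> 0 = \<one>\<^bsub>jacobi_group\<^esub>"
    using hom[of 0 0] car[of 0] by (simp add: r_cancel_one')
  have "jacobi_flow L \<gamma>" unfolding jacobi_flow_def
  proof
    fix t
    obtain A \<xi> r where L: "L = (A, \<xi>, r)" by (cases L)
    obtain M X \<kappa> where \<gamma>: "\<gamma> t = (M, X, \<kappa>)" by (cases "\<gamma> t")
    have "((\<lambda>s. \<gamma> (t + s)) has_vector_derivative
        (M ** mat_of_sl2 A, X v* mat_of_sl2 A + \<xi>, r + \<Omega> X \<xi>)) (at 0)"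
      using has_vector_derivative_jacobi_mult[of \<gamma> "mat_of_sl2 A" \<xi> r 0 M X \<kappa>] d
      by (simp add: hom \<gamma> L one jacobi_tangent_def) (simp add: jacobi_group_def Omega.zero_right)
    \<comment> \<open>The base point 0 is written as t - t, the value at t of the inner map s - t in
      the chain rule that moves the derivative to t.\<close>
    then have "(\<gamma> \<circ> (\<lambda>s. t + s) has_vector_derivative
        (M ** mat_of_sl2 A, X v* mat_of_sl2 A + \<xi>, r + \<Omega> X \<xi>)) (at (t - t))"
      by (simp add: o_def)
    moreover have "((\<lambda>s. s - t) has_vector_derivative 1) (at t)"
      by (auto intro!: derivative_eq_intros)
    ultimately have "((\<gamma> \<circ> (\<lambda>s. t + s)) \<circ> (\<lambda>s. s - t) has_vector_derivative
        1 *\<^sub>R (M ** mat_of_sl2 A, X v* mat_of_sl2 A + \<xi>, r + \<Omega> X \<xi>)) (at t)"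
      by (rule vector_diff_chain_at[rotated])
    then show "(\<gamma> has_vector_derivative jacobi_field_linear L (\<gamma> t) + jacobi_field_const L) (at t)"
      by (simp add: o_def L \<gamma> add.commute)
  qed
  with one show "jacobi_flow L \<gamma> \<and> \<gamma> 0 = \<one>\<^bsub>jacobi_group\<^esub>" by simp
next
  assume *: "jacobi_flow L \<gamma> \<and> \<gamma> 0 = \<one>\<^bsub>jacobi_group\<^esub>"
  interpret group jacobi_group by (rule group_jacobi_group)
  \<comment> \<open>The equation alone does not mention determinant 1; uniqueness identifies
    \<gamma> with the constructed solution, which is known to stay in the group.\<close>
  obtain \<gamma>' where "jacobi_flow L \<gamma>'" "\<gamma>' 0 = \<one>\<^bsub>jacobi_group\<^esub>" "range \<gamma>' \<subseteq> carrier jacobi_group"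
    by (rule jacobi_flow_exists)
  with * have car: "range \<gamma> \<subseteq> carrier jacobi_group"
    using jacobi_flow_unique[of L \<gamma> \<gamma>'] by simp
  have "\<gamma> (s + t) = \<gamma> s \<otimes>\<^bsub>jacobi_group\<^esub> \<gamma> t" for s t
  proof -
    have "jacobi_flow L (\<lambda>t. \<gamma> (s + t))"
      unfolding jacobi_flow_def
    proof
      fix t
      have "((\<lambda>t. s + t) has_vector_derivative 1) (at t)"
        by (auto intro!: derivative_eq_intros)
      moreover have "(\<gamma> has_vector_derivative jacobi_field_linear L (\<gamma> (s + t)) + jacobi_field_const L)
          (at (s + t))"
        using * by (simp add: jacobi_flow_def)
      ultimately show "((\<lambda>t. \<gamma> (s + t)) has_vector_derivative
          jacobi_field_linear L (\<gamma> (s + t)) + jacobi_field_const L) (at t)"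
        using vector_diff_chain_at[of "\<lambda>t. s + t" 1 t \<gamma>] by (simp add: o_def)
    qed
    moreover have "\<gamma> s \<otimes>\<^bsub>jacobi_group\<^esub> \<gamma> 0 = \<gamma> s"
      using * r_one[of "\<gamma> s"] car by (auto simp: image_subset_iff)
    ultimately have "(\<lambda>t. \<gamma> (s + t)) = (\<lambda>t. \<gamma> s \<otimes>\<^bsub>jacobi_group\<^esub> \<gamma> t)"
      using jacobi_flow_left_mult[of L \<gamma> "\<gamma> s"] * by (intro jacobi_flow_unique) auto
    then show ?thesis by (rule fun_cong)
  qed
  moreover have "(\<gamma> has_vector_derivative jacobi_tangent L) (at 0)"
    using * unfolding jacobi_flow_def by (metis jacobi_field_one)
  ultimately show "one_parameter_subgroup jacobi_group jacobi_tangent L \<gamma>"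
    using car smooth_on_jacobi_flow[of L \<gamma>] * by (auto simp: one_parameter_subgroup_def)
qed

section \<open>Exponential map and infinitesimal action\<close>

text \<open>The one-parameter subgroup of t L is s |-> \<gamma>(t s), evaluated at s = 1.\<close>

lemma lie_exp_jacobi:
  assumes "jacobi_flow L \<gamma>" "\<gamma> 0 = \<one>\<^bsub>jacobi_group\<^esub>"
  shows "lie_exp jacobi_group jacobi_tangent (t *\<^sub>R L) = \<gamma> t"
proof -
  have *: "jacobi_flow (t *\<^sub>R L) (\<lambda>s. \<gamma> (t * s))" by (rule jacobi_flow_scale[OF assms(1)])
  have "(THE \<gamma>. one_parameter_subgroup jacobi_group jacobi_tangent (t *\<^sub>R L) \<gamma>) = (\<lambda>s. \<gamma> (t * s))"
    unfolding one_parameter_subgroup_iff_flow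
    by (rule the_equality) (use * assms(2) in \<open>auto intro!: jacobi_flow_unique[OF _ *]\<close>)
  then show ?thesis by (simp add: lie_exp_def)
qed

text \<open>Infinitesimal action. For B with rows (a, b) and (c, -a), the first component is the
  familiar b + 2a\<tau> - c\<tau>^2 of Moebius transformations.\<close>

fun jacobi_vector_field :: "jacobi_algebra \<Rightarrow> complex \<times> complex \<Rightarrow> complex \<times> complex"
  where "jacobi_vector_field (A, \<xi>, r) (\<tau>, z) = (let B = mat_of_sl2 A in
    (of_real (B$1$1) * \<tau> + of_real (B$1$2) - \<tau> * (of_real (B$2$1) * \<tau> + of_real (B$2$2)),
     of_real (\<xi>$1) * \<tau> + of_real (\<xi>$2) - z * (of_real (B$2$1) * \<tau> + of_real (B$2$2))))"

lemma fundamental_vector_field_jacobi: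
  "fundamental_vector_field jacobi_group jacobi_tangent jacobi_act L p = jacobi_vector_field L p"
proof -
  obtain \<gamma> where \<gamma>: "jacobi_flow L \<gamma>" "\<gamma> 0 = \<one>\<^bsub>jacobi_group\<^esub>" by (rule jacobi_flow_exists)
  obtain A \<xi> r where L: "L = (A, \<xi>, r)" by (cases L)
  obtain \<tau> z where p: "p = (\<tau>, z)" by (cases p)
  define M where "M t = fst (\<gamma> t)" for t
  define X where "X t = fst (snd (\<gamma> t))" for t
  have "(\<gamma> has_vector_derivative (mat_of_sl2 A, \<xi>, r)) (at 0)"
    using \<gamma> jacobi_field_one[of L] unfolding jacobi_flow_def
    by (auto simp: L jacobi_tangent_def dest: spec[of _ 0])
  note d = has_vector_derivative_fst_snd[OF this, folded M_def X_def]
  have 0: "M 0 = mat 1" "X 0 = 0" using \<gamma>(2) by (simp_all add: M_def X_def jacobi_group_def)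
  have m: "((\<lambda>t. of_real (M t $ i $ j) :: complex) has_vector_derivative of_real (mat_of_sl2 A $ i $ j)) (at 0)"
    for i j
    by (rule bounded_linear.has_vector_derivative[OF bounded_linear_of_real
          has_vector_derivative_matrix_entry[OF d(1)]])
  have x: "((\<lambda>t. of_real (X t $ i) :: complex) has_vector_derivative of_real (\<xi> $ i)) (at 0)" for i
    by (rule bounded_linear.has_vector_derivative[OF bounded_linear_of_real
          bounded_linear.has_vector_derivative[OF bounded_linear_vec_nth d(2)]])
  \<comment> \<open>Both components of the action share a denominator that is 1 at time 0, so the
    quotient rule loses its division.\<close>
  have quotient: "((\<lambda>t. n t / q t) has_vector_derivative n' - n 0 * q') (at 0)"
    if n: "(n has_vector_derivative n') (at 0)" and q: "(q has_vector_derivative q') (at 0)" and "q 0 = 1"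
    for n q :: "real \<Rightarrow> complex" and n' q'
    using has_derivative_divide[OF n[unfolded has_vector_derivative_def] q[unfolded has_vector_derivative_def]]
      \<open>q 0 = 1\<close>
    by (simp add: has_vector_derivative_def algebra_simps)
  have "((\<lambda>t. jacobi_act (\<gamma> t) p) has_vector_derivative jacobi_vector_field L p) (at 0)"
  proof -
    have "jacobi_act (\<gamma> t) p =
      ((of_real (M t $1$1) * \<tau> + of_real (M t $1$2)) / (of_real (M t $2$1) * \<tau> + of_real (M t $2$2)),
       (z + of_real (X t $1) * \<tau> + of_real (X t $2)) / (of_real (M t $2$1) * \<tau> + of_real (M t $2$2)))" for t
      by (cases "\<gamma> t") (simp add: p M_def X_def)
    moreover have "((\<lambda>t. (of_real (M t $1$1) * \<tau> + of_real (M t $1$2)) / (of_real (M t $2$1) * \<tau> + of_real (M t $2$2)))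
        has_vector_derivative fst (jacobi_vector_field L p)) (at 0)"
    proof -
      have "((\<lambda>t. (of_real (M t $1$1) * \<tau> + of_real (M t $1$2)) / (of_real (M t $2$1) * \<tau> + of_real (M t $2$2)))
        has_vector_derivative (of_real (mat_of_sl2 A $1$1) * \<tau> + of_real (mat_of_sl2 A $1$2)) -
        (of_real (M 0 $1$1) * \<tau> + of_real (M 0 $1$2)) *
        (of_real (mat_of_sl2 A $2$1) * \<tau> + of_real (mat_of_sl2 A $2$2))) (at 0)"
        by (intro quotient has_vector_derivative_add has_vector_derivative_mult_left m)
          (simp add: 0 mat_def)
      then show ?thesis by (simp add: L p Let_def 0 mat_def)
    qed
    moreover have "((\<lambda>t. (z + of_real (X t $1) * \<tau> + of_real (X t $2)) / (of_real (M t $2$1) * \<tau> + of_real (M t $2$2)))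
        has_vector_derivative snd (jacobi_vector_field L p)) (at 0)"
    proof -
      have "((\<lambda>t. (z + of_real (X t $1) * \<tau> + of_real (X t $2)) / (of_real (M t $2$1) * \<tau> + of_real (M t $2$2)))
        has_vector_derivative (0 + of_real (\<xi> $1) * \<tau> + of_real (\<xi> $2)) -
        (z + of_real (X 0 $1) * \<tau> + of_real (X 0 $2)) *
        (of_real (mat_of_sl2 A $2$1) * \<tau> + of_real (mat_of_sl2 A $2$2))) (at 0)"
        by (intro quotient has_vector_derivative_add has_vector_derivative_mult_left m x
            has_vector_derivative_const) (simp add: 0 mat_def)
      then show ?thesis by (simp add: L p Let_def 0 mat_def)
    qed
    ultimately show ?thesis
      using has_vector_derivative_Pair[of _ "fst (jacobi_vector_field L p)" _ _ _ "snd (jacobi_vector_field L p)"]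
      by (simp del: jacobi_vector_field.simps)
  qed
  then show ?thesis
    unfolding fundamental_vector_field_def lie_exp_jacobi[OF \<gamma>] by (rule vector_derivative_at)
qed


section \<open>The Hamiltonian functions\<close>

text \<open>By trace 0 the basis coordinates are matrix entries, so linearity turns six prescribed
  values into a formula for every L.\<close>

lemma jacobi_algebra_expand:
  "(A, \<xi>, r) = (mat_of_sl2 A $ 1 $ 2) *\<^sub>R jF + (mat_of_sl2 A $ 2 $ 1) *\<^sub>R jG + (mat_of_sl2 A $ 1 $ 1) *\<^sub>R jH
    + (\<xi> $ 1) *\<^sub>R jP + (\<xi> $ 2) *\<^sub>R jQ + r *\<^sub>R jR"
proof -
  have "A = (mat_of_sl2 A $ 1 $ 2) *\<^sub>R F_sl2 + (mat_of_sl2 A $ 2 $ 1) *\<^sub>R G_sl2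
      + (mat_of_sl2 A $ 1 $ 1) *\<^sub>R H_sl2"
    by (simp add: mat_of_sl2_inject[symmetric] plus_sl2.rep_eq scaleR_sl2.rep_eq mat_of_sl2_basis
        matrix_2_eq_iff mat_of_sl2_trace_free)
  moreover have "\<xi> = (\<xi> $ 1) *\<^sub>R vector [1, 0] + (\<xi> $ 2) *\<^sub>R vector [0, 1]"
    by (simp add: vec_eq_iff forall_2)
  ultimately show ?thesis
    by (simp add: jF_def jG_def jH_def jP_def jQ_def jR_def)
qed

text \<open>\<psi>(L) after substituting \<eta>1 = y/(2v) and \<eta>2 = (y^2 + 2v)/(4v^2). Up to
  constants only powers of v occur as denominators.\<close>

fun jacobi_hamiltonian :: "jacobi_algebra \<Rightarrow> complex \<times> complex \<Rightarrow> real"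
  where "jacobi_hamiltonian (A, \<xi>, r) p =
    (let B = mat_of_sl2 A; u = Re (fst p); v = Im (fst p); x = Re (snd p); y = Im (snd p) in
      B$1$2 * (- (y\<^sup>2 + 2 * v) / (4 * v\<^sup>2))
      + B$2$1 * (x\<^sup>2 / 4 + (y\<^sup>2 + 2 * v) * u\<^sup>2 / (4 * v\<^sup>2) - x * y * u / (2 * v) + v / 2)
      + B$1$1 * (x * y / (2 * v) - (y\<^sup>2 + 2 * v) * u / (2 * v\<^sup>2))
      + \<xi>$1 * (y * u / (2 * v) - x / 2) + \<xi>$2 * (y / (2 * v)) - r / 4)"

lemma open_siegel_jacobi: "open siegel_jacobi"
proof -
  have *: "siegel_jacobi = {p. 0 < Im (fst p)}" by (auto simp: siegel_jacobi_def)
  show ?thesis unfolding * by (intro open_Collect_less continuous_intros)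
qed

lemma smooth_on_jacobi_hamiltonian: "smooth_on siegel_jacobi (jacobi_hamiltonian L)"
proof -
  obtain A \<xi> r where L: "L = (A, \<xi>, r)" by (cases L)
  note c = smooth_on_const[OF open_siegel_jacobi]
  note id = smooth_on_id[OF open_siegel_jacobi]
  note \<tau> = smooth_on_bounded_linear[OF bounded_linear_fst id]
  note z = smooth_on_bounded_linear[OF bounded_linear_snd id]
  note coords = smooth_on_bounded_linear[OF bounded_linear_Re \<tau>] smooth_on_bounded_linear[OF bounded_linear_Im \<tau>]
    smooth_on_bounded_linear[OF bounded_linear_Re z] smooth_on_bounded_linear[OF bounded_linear_Im z]
  have "smooth_on siegel_jacobi (\<lambda>p. jacobi_hamiltonian (A, \<xi>, r) p)"
    unfolding jacobi_hamiltonian.simps Let_def power2_eq_square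
    by (intro smooth_on_add smooth_on_diff smooth_on_mult smooth_on_minus smooth_on_divide c coords)
      (auto simp: siegel_jacobi_def)
  then show ?thesis by (simp only: L)
qed

text \<open>The core computation. Both sides are linear forms in the tangent vector; eliminating the
  lower right entry of the matrix by trace 0 and clearing powers of v leaves a polynomial
  identity.\<close>

lemma has_derivative_jacobi_hamiltonian:
  assumes "p \<in> siegel_jacobi"
  shows "(jacobi_hamiltonian L has_derivative \<omega>_KB p (jacobi_vector_field L p)) (at p)"
proof -
  obtain A \<xi> r where L: "L = (A, \<xi>, r)" by (cases L)
  obtain u v x y where p: "p = (Complex u v, Complex x y)" by (metis complex_surj surj_pair)
  have v: "v \<noteq> 0" using assms by (auto simp: p siegel_jacobi_def)
  have "((\<lambda>q. jacobi_hamiltonian (A, \<xi>, r) q) has_derivative \<omega>_KB p (jacobi_vector_field L p)) (at p)"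
    unfolding jacobi_hamiltonian.simps Let_def
    by ((rule derivative_eq_intros refl | simp add: p v; fail)+, rule ext)
      (use v in \<open>auto simp: p L mat_of_sl2_trace_free Let_def \<omega>_KB_def g_KB_expand complex_structure_def
        field_simps power2_eq_square power3_eq_cube\<close>)
  then show ?thesis by (simp only: L)
qed

theorem proposition3p41:
  fixes \<psi> :: "jacobi_algebra \<Rightarrow> complex \<times> complex \<Rightarrow> real"
    and J :: "complex \<times> complex \<Rightarrow> jacobi_algebra \<Rightarrow>\<^sub>L real"
  assumes linear: "\<And>p. p \<in> siegel_jacobi \<Longrightarrow> linear (\<lambda>L. \<psi> L p)"
    and F: "\<And>p. p \<in> siegel_jacobi \<Longrightarrow> \<psi> jF p = - \<eta>2 p"
    and G: "\<And>p. p \<in> siegel_jacobi \<Longrightarrow> \<psi> jG p =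
        1/4 * (d\<theta>1 p)\<^sup>2 + \<eta>2 p * (d\<theta>2 p)\<^sup>2 + \<eta>1 p * d\<theta>1 p * d\<theta>2 p
        - 1 / (4 * ((\<eta>1 p)\<^sup>2 - \<eta>2 p))"
    and H: "\<And>p. p \<in> siegel_jacobi \<Longrightarrow> \<psi> jH p = - \<eta>1 p * d\<theta>1 p - 2 * \<eta>2 p * d\<theta>2 p"
    and P: "\<And>p. p \<in> siegel_jacobi \<Longrightarrow> \<psi> jP p = 1/2 * d\<theta>1 p + \<eta>1 p * d\<theta>2 p"
    and Q: "\<And>p. p \<in> siegel_jacobi \<Longrightarrow> \<psi> jQ p = \<eta>1 p"
    and R: "\<And>p. p \<in> siegel_jacobi \<Longrightarrow> \<psi> jR p = - 1/4"
    and J: "\<And>p L. p \<in> siegel_jacobi \<Longrightarrow> blinfun_apply (J p) L = \<psi> L p"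
  shows "(\<forall>L. smooth_on siegel_jacobi (\<psi> L)) \<and>
    (\<forall>L. \<forall>p\<in>siegel_jacobi.
       hamiltonian_vector_field \<omega>_KB (\<psi> L) p =
       fundamental_vector_field jacobi_group jacobi_tangent jacobi_act L p) \<and>
    is_momentum_map siegel_jacobi \<omega>_KB jacobi_group jacobi_tangent jacobi_act J"
proof -
  have \<psi>: "\<psi> L p = jacobi_hamiltonian L p" if p: "p \<in> siegel_jacobi" for L p
  proof -
    interpret linear "\<lambda>L. \<psi> L p" by (rule linear[OF p])
    obtain A \<xi> r where L: "L = (A, \<xi>, r)" by (cases L)
    have v: "Im (fst p) \<noteq> 0" using p by (auto simp: siegel_jacobi_def)
    \<comment> \<open>The y^2 terms cancel, so the fractional last term of \<psi>(G) is v/2 in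
      disguise.\<close>
    then have "(\<eta>1 p)\<^sup>2 - \<eta>2 p = - 1 / (2 * Im (fst p))"
      by (simp add: \<eta>1_def \<eta>2_def \<theta>1_def \<theta>2_def field_simps power2_eq_square)
    then have G': "\<psi> jG p = 1/4 * (d\<theta>1 p)\<^sup>2 + \<eta>2 p * (d\<theta>2 p)\<^sup>2 + \<eta>1 p * d\<theta>1 p * d\<theta>2 p + Im (fst p) / 2"
      using G[OF p] by simp
    have "\<psi> L p = mat_of_sl2 A $ 1 $ 2 * \<psi> jF p + mat_of_sl2 A $ 2 $ 1 * \<psi> jG p
        + mat_of_sl2 A $ 1 $ 1 * \<psi> jH p + \<xi> $ 1 * \<psi> jP p + \<xi> $ 2 * \<psi> jQ p + r * \<psi> jR p"
      unfolding L by (subst jacobi_algebra_expand) (simp only: add scale real_scaleR_def)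
    also have "\<dots> = jacobi_hamiltonian L p"
      using v by (simp add: F[OF p] G' H[OF p] P[OF p] Q[OF p] R[OF p] L Let_def
          \<eta>1_def \<eta>2_def \<theta>1_def \<theta>2_def d\<theta>1_def d\<theta>2_def field_simps power2_eq_square)
    finally show ?thesis .
  qed
  \<comment> \<open>\<open>f\<close> is kept general to cover both \<open>\<psi> L\<close> and the
    evaluation of \<open>J\<close> at \<open>L\<close>; agreement on the open space determines the
    derivative at p.\<close>
  have ham: "hamiltonian_vector_field \<omega>_KB f p =
      fundamental_vector_field jacobi_group jacobi_tangent jacobi_act L p"
    if p: "p \<in> siegel_jacobi" and f: "\<And>q. q \<in> siegel_jacobi \<Longrightarrow> f q = jacobi_hamiltonian L q" for f L p
    unfolding fundamental_vector_field_jacobi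
    by (intro hamiltonian_vector_field_siegel_jacobi p
        has_derivative_transform_within_open[OF has_derivative_jacobi_hamiltonian[OF p]
          open_siegel_jacobi p]) (simp add: f)
  have smooth: "smooth_on siegel_jacobi f"
    if "\<And>q. q \<in> siegel_jacobi \<Longrightarrow> f q = jacobi_hamiltonian L q" for f L
    by (rule smooth_on_cong[OF smooth_on_jacobi_hamiltonian]) (simp add: that)
  have "smooth_on siegel_jacobi J"
    by (rule smooth_on_blinfun[OF open_siegel_jacobi smooth]) (simp add: J \<psi>)
  moreover have "fundamental_vector_field jacobi_group jacobi_tangent jacobi_act L p =
      hamiltonian_vector_field \<omega>_KB (\<lambda>q. blinfun_apply (J q) L) p" if "p \<in> siegel_jacobi" for L p
    by (rule ham[symmetric, OF that]) (simp add: J \<psi>)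
  moreover have "smooth_on siegel_jacobi (\<psi> L)" for L
    by (rule smooth) (rule \<psi>)
  moreover have "hamiltonian_vector_field \<omega>_KB (\<psi> L) p =
      fundamental_vector_field jacobi_group jacobi_tangent jacobi_act L p"
    if "p \<in> siegel_jacobi" for L p
    by (rule ham[OF that \<psi>])
  ultimately show ?thesis
    unfolding is_momentum_map_def by blast
qed

end
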